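(* Let the kernel pair $(M(x),K(x))$ belong to the Luchko set $\mathcal{L}_1(\mathbb{R}_+)$ and let $-\infty<a<b<+\infty$. Then the parametric general fractional integral and the parametric general fractional derivative of Riemann-Liouville type satisfy the equalities $$(D^{(K)}_{a+,g}\,I^{(M)}_{a+,g}f)(x)=f(x),$$ if $f\in C^1_{-1,g}(a,b]$ and $g\in\mathcal{G}(a,b]$, and $$(D^{(K)}_{b-,g}\,I^{(M)}_{b-,g}f)(x)=f(x),$$ if $f\in C^1_{-1,g}[a,b)$ and $g\in\mathcal{G}[a,b)$.
   Context: Function classes. $\mathcal{G}(a,b]$ (resp. $\mathcal{G}[a,b)$) is the set of increasing and positive monotone functions $g$ on $(a,b)$ having a continuous first-order derivative $g^{(1)}$ on $(a,b]$ (resp. on $[a,b)$) such that $g^{(1)}(x)\ne0$ for all $x\in[a,b]$. $f\in C^1_{-1,g}(a,b]$ means that the first-order derivative of $f$ can be represented as $f^{(1)}(x)=(g(x)-g(a))^p\,v_p(x)$ with $v_p\in C[a,b]$ and $p>-1$. $f\in C^1_{-1,g}[a,b)$ means that $f^{(1)}(x)=(g(b)-g(x))^q\,v_q(x)$ with $v_q\in C[a,b]$ and $q>-1$. Kernels. The Luchko set $\mathcal{L}_1(\mathbb{R}_+)$ consists of the pairs $(M(x),K(x))$, $x\in\mathbb{R}_+=(0,\infty)$, such that $M,K\in C_{-1}(0,b-a]$ and the Sonin condition holds: $$\int_0^x M(x-z)K(z)\,dz=\begin{cases}1,& x\in(0,b-a],\\ 0,& x\notin(0,b-a].\end{cases}$$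 Here $F\in C_{-1}(0,b-a]$ means $F(x)=x^pG(x)$ for some $G\in C[0,b-a]$ and $p>-1$. Operators. For $a<x\le b$ (left-sided) and $a\le x<b$ (right-sided): $$(I^{(M)}_{a+,g}f)(x)=\int_a^x M(g(x)-g(u))f(u)g^{(1)}(u)\,du,\qquad (I^{(M)}_{b-,g}f)(x)=\int_x^b M(g(u)-g(x))f(u)g^{(1)}(u)\,du,$$ $$(D^{(K)}_{a+,g}f)(x)=\frac{1}{g^{(1)}(x)}\frac{d}{dx}\int_a^x K(g(x)-g(u))f(u)g^{(1)}(u)\,du,$$ $$(D^{(K)}_{b-,g}f)(x)=-\frac{1}{g^{(1)}(x)}\frac{d}{dx}\int_x^b K(g(u)-g(x))f(u)g^{(1)}(u)\,du.$$
   Formalization: The Luchko set is taken relative to an interval (0,T] with g(b)-g(a) ≤ T in place of (0,b-a], because with (0,b-a] the equalities fail when g(b)-g(a) > b-a. *)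

theory Defs
  imports "HOL-Analysis.Analysis"
begin

text \<open>
  First-order derivatives on a compact interval \<open>[a, b]\<close>: two-sided at interior points,
  one-sided at the endpoints.
\<close>

abbreviation deriv_on :: "real \<Rightarrow> real \<Rightarrow> (real \<Rightarrow> real) \<Rightarrow> real \<Rightarrow> real" where
  "deriv_on a b F x \<equiv> vector_derivative F (at x within {a..b})"

text \<open>
  The classes \<open>G(a,b]\<close> and \<open>G[a,b)\<close>. Both endpoint values of \<open>g\<close> enter the theory, so
  monotonicity is imposed on all of \<open>[a, b]\<close>. The derivative need not exist at the excluded
  endpoint; there the nonvanishing condition means that it is not zero if it does exist.
\<close>

definition G_left :: "real \<Rightarrow> real \<Rightarrow> (real \<Rightarrow> real) set" where
  "G_left a b = {g. strict_mono_on {a..b} g \<and> (\<forall>x\<in>{a<..<b}. g x > 0) \<and>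
     (\<forall>x\<in>{a<..b}. g differentiable (at x within {a..b})) \<and>
     continuous_on {a<..b} (deriv_on a b g) \<and>
     (\<forall>x\<in>{a..b}. g differentiable (at x within {a..b}) \<longrightarrow> deriv_on a b g x \<noteq> 0)}"

definition G_right :: "real \<Rightarrow> real \<Rightarrow> (real \<Rightarrow> real) set" where
  "G_right a b = {g. strict_mono_on {a..b} g \<and> (\<forall>x\<in>{a<..<b}. g x > 0) \<and>
     (\<forall>x\<in>{a..<b}. g differentiable (at x within {a..b})) \<and>
     continuous_on {a..<b} (deriv_on a b g) \<and>
     (\<forall>x\<in>{a..b}. g differentiable (at x within {a..b}) \<longrightarrow> deriv_on a b g x \<noteq> 0)}"

text \<open>The classes \<open>C\<^sup>1\<^bsub>-1,g\<^esub>(a,b]\<close> and \<open>C\<^sup>1\<^bsub>-1,g\<^esub>[a,b)\<close>.\<close>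

definition C1_left :: "real \<Rightarrow> real \<Rightarrow> (real \<Rightarrow> real) \<Rightarrow> (real \<Rightarrow> real) set" where
  "C1_left a b g = {f. \<exists>p v. p > -1 \<and> continuous_on {a..b} v \<and>
     (\<forall>x\<in>{a<..b}. (f has_real_derivative (g x - g a) powr p * v x) (at x within {a..b}))}"

definition C1_right :: "real \<Rightarrow> real \<Rightarrow> (real \<Rightarrow> real) \<Rightarrow> (real \<Rightarrow> real) set" where
  "C1_right a b g = {f. \<exists>q v. q > -1 \<and> continuous_on {a..b} v \<and>
     (\<forall>x\<in>{a..<b}. (f has_real_derivative (g b - g x) powr q * v x) (at x within {a..b}))}"

text \<open>The class \<open>C\<^bsub>-1\<^esub>(0,T]\<close> and the Luchko set of Sonin kernel pairs relative to \<open>(0,T]\<close>.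
  The operators evaluate the kernels at differences of values of \<open>g\<close>, so \<open>T\<close> is a parameter
  to be chosen with \<open>g b - g a \<le> T\<close>; \<open>T = b - a\<close> alone does not suffice if \<open>g b - g a > b - a\<close>.\<close>

definition C_minus1 :: "real \<Rightarrow> (real \<Rightarrow> real) set" where
  "C_minus1 T = {F. \<exists>p G. p > -1 \<and> continuous_on {0..T} G \<and> (\<forall>x\<in>{0<..T}. F x = x powr p * G x)}"

definition luchko_set :: "real \<Rightarrow> ((real \<Rightarrow> real) \<times> (real \<Rightarrow> real)) set" where
  "luchko_set T = {(M, K). M \<in> C_minus1 T \<and> K \<in> C_minus1 T \<and>
     (\<forall>x>0. set_integrable lborel {0<..<x} (\<lambda>z. M (x - z) * K z) \<and>
        (LINT z:{0<..<x}|lborel. M (x - z) * K z) = (if x \<in> {0<..T} then 1 else 0))}"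

text \<open>
  The parametric general fractional integrals and Riemann--Liouville type derivatives. The
  integral inside the derivative has the same shape as the fractional integral, with kernel
  \<open>K\<close> in place of \<open>M\<close>. As the Lebesgue integral and \<^const>\<open>vector_derivative\<close> are total
  functions, well-definedness is expressed by separate predicates.
\<close>

definition gfi_left ::
  "(real \<Rightarrow> real) \<Rightarrow> real \<Rightarrow> real \<Rightarrow> (real \<Rightarrow> real) \<Rightarrow> (real \<Rightarrow> real) \<Rightarrow> real \<Rightarrow> real" where
  "gfi_left M a b g f x = (LINT u:{a<..<x}|lborel. M (g x - g u) * f u * deriv_on a b g u)"

definition gfi_right ::
  "(real \<Rightarrow> real) \<Rightarrow> real \<Rightarrow> real \<Rightarrow> (real \<Rightarrow> real) \<Rightarrow> (real \<Rightarrow> real) \<Rightarrow> real \<Rightarrow> real" where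
  "gfi_right M a b g f x = (LINT u:{x<..<b}|lborel. M (g u - g x) * f u * deriv_on a b g u)"

definition gfi_left_exists ::
  "(real \<Rightarrow> real) \<Rightarrow> real \<Rightarrow> real \<Rightarrow> (real \<Rightarrow> real) \<Rightarrow> (real \<Rightarrow> real) \<Rightarrow> real \<Rightarrow> bool" where
  "gfi_left_exists M a b g f x \<longleftrightarrow>
     set_integrable lborel {a<..<x} (\<lambda>u. M (g x - g u) * f u * deriv_on a b g u)"

definition gfi_right_exists ::
  "(real \<Rightarrow> real) \<Rightarrow> real \<Rightarrow> real \<Rightarrow> (real \<Rightarrow> real) \<Rightarrow> (real \<Rightarrow> real) \<Rightarrow> real \<Rightarrow> bool" where
  "gfi_right_exists M a b g f x \<longleftrightarrow>
     set_integrable lborel {x<..<b} (\<lambda>u. M (g u - g x) * f u * deriv_on a b g u)"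

definition gfd_left ::
  "(real \<Rightarrow> real) \<Rightarrow> real \<Rightarrow> real \<Rightarrow> (real \<Rightarrow> real) \<Rightarrow> (real \<Rightarrow> real) \<Rightarrow> real \<Rightarrow> real" where
  "gfd_left K a b g f x = 1 / deriv_on a b g x * deriv_on a b (gfi_left K a b g f) x"

definition gfd_right ::
  "(real \<Rightarrow> real) \<Rightarrow> real \<Rightarrow> real \<Rightarrow> (real \<Rightarrow> real) \<Rightarrow> (real \<Rightarrow> real) \<Rightarrow> real \<Rightarrow> real" where
  "gfd_right K a b g f x = - (1 / deriv_on a b g x) * deriv_on a b (gfi_right K a b g f) x"

definition gfd_left_exists ::
  "(real \<Rightarrow> real) \<Rightarrow> real \<Rightarrow> real \<Rightarrow> (real \<Rightarrow> real) \<Rightarrow> (real \<Rightarrow> real) \<Rightarrow> real \<Rightarrow> bool" where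
  "gfd_left_exists K a b g f x \<longleftrightarrow> (\<forall>t\<in>{a<..b}. gfi_left_exists K a b g f t) \<and>
     gfi_left K a b g f differentiable (at x within {a..b})"

definition gfd_right_exists ::
  "(real \<Rightarrow> real) \<Rightarrow> real \<Rightarrow> real \<Rightarrow> (real \<Rightarrow> real) \<Rightarrow> (real \<Rightarrow> real) \<Rightarrow> real \<Rightarrow> bool" where
  "gfd_right_exists K a b g f x \<longleftrightarrow> (\<forall>t\<in>{a..<b}. gfi_right_exists K a b g f t) \<and>
     gfi_right K a b g f differentiable (at x within {a..b})"

end

theory Submission
  imports Defs
begin

text \<open>
  Put \<open>h = g - inf g\<close> in the left-sided case and \<open>h = sup g - g\<close> in the right-sided one. Substituting
  \<open>s = h u\<close> turns every operator into a convolution on \<open>(0, L]\<close> applied to \<open>F = f \<circ> h\<^sup>-\<^sup>1\<close>. The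
  integrable functions that vanish on \<open>(-\<infinity>, 0]\<close> and are bounded on each \<open>[d, \<infinity>)\<close>, \<open>d > 0\<close>, are closed
  under convolution, which on them is defined at every point and associative there, so the Sonin condition gives
  \<open>(K * (M * F)) y = ((K * M) * F) y = \<integral>\<^sub>0\<^sup>y F\<close>, and differentiation finishes the proof. What needs an
  argument is that \<open>F\<close> is integrable at 0: \<open>g\<close> may behave badly at the excluded endpoint (it may
  even jump there), and only \<open>\<bar>f'\<bar> h\<close> is known to be bounded.
\<close>

section \<open>Convolution of causal kernels\<close>

text \<open>The integral runs over the whole line without cut-offs: for causal kernels the integrand
  vanishes outside (0, y).\<close>

definition conv :: "(real \<Rightarrow> real) \<Rightarrow> (real \<Rightarrow> real) \<Rightarrow> real \<Rightarrow> real" where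
  "conv A F y = (LINT s|lborel. A (y - s) * F s)"

text \<open>The bounds hold pointwise, not just almost everywhere, and leave 0 as the only possible
  singularity.\<close>

definition causal_kernel :: "(real \<Rightarrow> real) \<Rightarrow> bool" where
  "causal_kernel F \<longleftrightarrow> integrable lborel F \<and> (\<forall>x\<le>0. F x = 0) \<and>
     (\<forall>d>0. \<exists>C. \<forall>x\<ge>d. \<bar>F x\<bar> \<le> C)"

lemma causal_kernel_integrable: "causal_kernel F \<Longrightarrow> integrable lborel F"
  and causal_kernel_nonpos: "causal_kernel F \<Longrightarrow> x \<le> 0 \<Longrightarrow> F x = 0"
  by (auto simp: causal_kernel_def)

lemma causal_kernel_bound:
  assumes "causal_kernel F" "d > 0"
  obtains C where "C \<ge> 0" "\<And>x. x \<ge> d \<Longrightarrow> \<bar>F x\<bar> \<le> C"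
proof -
  obtain C where "\<forall>x\<ge>d. \<bar>F x\<bar> \<le> C"
    using assms by (auto simp: causal_kernel_def)
  then show ?thesis
    using that[of C] abs_ge_zero order_trans by blast
qed

lemma causal_kernel_measurable: "causal_kernel F \<Longrightarrow> F \<in> borel_measurable borel"
  using borel_measurable_integrable[OF causal_kernel_integrable] by simp

lemma causal_kernel_abs: "causal_kernel F \<Longrightarrow> causal_kernel (\<lambda>x. \<bar>F x\<bar>)"
  by (auto simp: causal_kernel_def)

lemma integrable_reflect_shift:
  fixes A :: "real \<Rightarrow> real"
  assumes "integrable lborel A"
  shows "integrable lborel (\<lambda>s. A (y - s))" "(LINT s|lborel. A (y - s)) = (LINT s|lborel. A s)"
  using lborel_integrable_real_affine[OF assms, of "-1" y] lborel_integral_real_affine[of "-1" A y]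
  by simp_all

text \<open>One of the two arguments \<open>y - s\<close> and \<open>s\<close> is at least \<open>y / 2\<close>.\<close>

lemma conv_integrand_bound:
  assumes A: "causal_kernel A" and F: "causal_kernel F" and "d > 0"
  obtains C where "\<And>y s. y \<ge> d \<Longrightarrow> \<bar>A (y - s) * F s\<bar> \<le> C * (\<bar>F s\<bar> + \<bar>A (y - s)\<bar>)"
proof -
  obtain CA where CA: "CA \<ge> 0" "\<And>x. x \<ge> d / 2 \<Longrightarrow> \<bar>A x\<bar> \<le> CA"
    using causal_kernel_bound[OF A, of "d / 2"] \<open>d > 0\<close> by (metis half_gt_zero)
  obtain CF where CF: "CF \<ge> 0" "\<And>x. x \<ge> d / 2 \<Longrightarrow> \<bar>F x\<bar> \<le> CF"
    using causal_kernel_bound[OF F, of "d / 2"] \<open>d > 0\<close> by (metis half_gt_zero)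
  have "\<bar>A (y - s) * F s\<bar> \<le> max CA CF * (\<bar>F s\<bar> + \<bar>A (y - s)\<bar>)" if y: "y \<ge> d" for y s
  proof -
    consider "s \<ge> d / 2" | "y - s \<ge> d / 2"
      using y by linarith
    then have "\<bar>A (y - s)\<bar> * \<bar>F s\<bar> \<le> max CA CF * \<bar>A (y - s)\<bar> \<or> \<bar>A (y - s)\<bar> * \<bar>F s\<bar> \<le> max CA CF * \<bar>F s\<bar>"
    proof cases
      case 1
      then have "\<bar>F s\<bar> \<le> max CA CF" using CF(2)[of s] by linarith
      then show ?thesis by (metis abs_ge_zero mult.commute mult_left_mono)
    next
      case 2
      then have "\<bar>A (y - s)\<bar> \<le> max CA CF" using CA(2)[of "y - s"] by linarith
      then show ?thesis by (metis abs_ge_zero mult_right_mono)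
    qed
    moreover have "0 \<le> max CA CF * \<bar>A (y - s)\<bar>" "0 \<le> max CA CF * \<bar>F s\<bar>"
      using CA(1) by (simp_all add: le_max_iff_disj)
    ultimately show ?thesis
      by (auto simp: abs_mult distrib_left)
  qed
  then show ?thesis using that by blast
qed

lemma conv_integrand_nonpos:
  assumes "causal_kernel A" "causal_kernel F" "y \<le> 0"
  shows "A (y - s) * F s = 0"
  using assms causal_kernel_nonpos[of F s] causal_kernel_nonpos[of A "y - s"] by (cases "s \<le> 0") auto

text \<open>For \<open>y > 0\<close> the bound above with \<open>d = y\<close> gives an integrable
  majorant. Convergence thus holds at every \<open>y\<close>, not just almost every one, as the
  pointwise identities below require.\<close>

lemma conv_integrable:
  assumes A: "causal_kernel A" and F: "causal_kernel F"
  shows "integrable lborel (\<lambda>s. A (y - s) * F s)"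
proof (cases "y > 0")
  case True
  obtain C where C: "\<And>y' s. y' \<ge> y \<Longrightarrow> \<bar>A (y' - s) * F s\<bar> \<le> C * (\<bar>F s\<bar> + \<bar>A (y' - s)\<bar>)"
    using conv_integrand_bound[OF A F True] by blast
  note [measurable] = causal_kernel_measurable[OF A] causal_kernel_measurable[OF F]
  show ?thesis
  proof (rule Bochner_Integration.integrable_bound)
    show "integrable lborel (\<lambda>s. C * (\<bar>F s\<bar> + \<bar>A (y - s)\<bar>))"
      using causal_kernel_integrable[OF A] causal_kernel_integrable[OF F]
      by (intro integrable_mult_right Bochner_Integration.integrable_add integrable_abs
          integrable_reflect_shift)
    show "AE s in lborel. norm (A (y - s) * F s) \<le> norm (C * (\<bar>F s\<bar> + \<bar>A (y - s)\<bar>))"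
      using C[OF order_refl] by (intro always_eventually allI) (smt (verit) real_norm_def)
  qed measurable
next
  case False
  then have "(\<lambda>s. A (y - s) * F s) = (\<lambda>_. 0)"
    by (intro ext conv_integrand_nonpos A F) simp
  then show ?thesis by (simp only: integrable_zero)
qed

text \<open>Integrating over \<open>y\<close> first leaves the L1 norm of \<open>A\<close> times
  \<open>\<bar>F s\<bar>\<close>, so Fubini gives integrability. Boundedness on [d, \<infinity>)
  holds because the constant in \<open>conv_integrand_bound\<close> is the same for all
  \<open>y \<ge> d\<close>.\<close>

lemma causal_kernel_conv:
  assumes A: "causal_kernel A" and F: "causal_kernel F"
  shows "causal_kernel (conv A F)"
  unfolding causal_kernel_def
proof (intro conjI allI impI)
  note [measurable] = causal_kernel_measurable[OF A] causal_kernel_measurable[OF F]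
  have "integrable (lborel \<Otimes>\<^sub>M lborel) (\<lambda>(s, y). A (y - s) * F s)"
  proof (rule lborel_pair.Fubini_integrable)
    have "(LINT y|lborel. norm (case (s, y) of (s, y) \<Rightarrow> A (y - s) * F s))
        = (LINT y|lborel. \<bar>A y\<bar>) * \<bar>F s\<bar>" for s
      using lborel_integral_real_affine[of 1 "\<lambda>y. \<bar>A y\<bar>" "- s"]
      by (simp add: abs_mult)
    then show "integrable lborel (\<lambda>s. LINT y|lborel. norm (case (s, y) of (s, y) \<Rightarrow> A (y - s) * F s))"
      using causal_kernel_integrable[OF F] by simp
    show "AE s in lborel. integrable lborel (\<lambda>y. case (s, y) of (s, y) \<Rightarrow> A (y - s) * F s)"
      using lborel_integrable_real_affine[OF causal_kernel_integrable[OF A], of 1 "- s" for s]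
      by simp
  qed measurable
  from lborel_pair.integrable_snd[OF this] show "integrable lborel (conv A F)"
    by (simp add: conv_def[abs_def])
next
  fix x :: real assume "x \<le> 0"
  then have "(\<lambda>s. A (x - s) * F s) = (\<lambda>_. 0)"
    by (intro ext conv_integrand_nonpos A F)
  then show "conv A F x = 0" by (simp only: conv_def Bochner_Integration.integral_zero)
next
  fix d :: real assume "d > 0"
  obtain C where C: "\<And>y s. y \<ge> d \<Longrightarrow> \<bar>A (y - s) * F s\<bar> \<le> C * (\<bar>F s\<bar> + \<bar>A (y - s)\<bar>)"
    using conv_integrand_bound[OF A F \<open>d > 0\<close>] by blast
  have "\<bar>conv A F y\<bar> \<le> C * ((LINT s|lborel. \<bar>F s\<bar>) + (LINT s|lborel. \<bar>A s\<bar>))" if "y \<ge> d" for y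
  proof -
    have "\<bar>conv A F y\<bar> \<le> (LINT s|lborel. \<bar>A (y - s) * F s\<bar>)"
      unfolding conv_def by (rule integral_abs_bound)
    also have "\<dots> \<le> (LINT s|lborel. C * (\<bar>F s\<bar> + \<bar>A (y - s)\<bar>))"
      using causal_kernel_integrable[OF A] causal_kernel_integrable[OF F] C[OF that]
      by (intro integral_mono integrable_abs conv_integrable A F integrable_mult_right
          Bochner_Integration.integrable_add integrable_reflect_shift)
    also have "\<dots> = C * ((LINT s|lborel. \<bar>F s\<bar>) + (LINT s|lborel. \<bar>A s\<bar>))"
      using causal_kernel_integrable[OF F] causal_kernel_integrable[OF A]
      by (simp add: integrable_reflect_shift[of "\<lambda>s. \<bar>A s\<bar>"])
    finally show ?thesis .
  qed
  then show "\<exists>C. \<forall>x\<ge>d. \<bar>conv A F x\<bar> \<le> C" by blast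
qed

text \<open>Fubini applies at each fixed \<open>y\<close> because the iterated convolution of the
  absolute values converges there. The order \<open>conv A B\<close> on the right builds in
  commutativity and matches the Sonin integral.\<close>

lemma conv_assoc:
  assumes A: "causal_kernel A" and B: "causal_kernel B" and F: "causal_kernel F"
  shows "conv B (conv A F) y = conv (conv A B) F y"
proof -
  note [measurable] = causal_kernel_measurable[OF A] causal_kernel_measurable[OF B]
    causal_kernel_measurable[OF F]
  have int: "integrable (lborel \<Otimes>\<^sub>M lborel) (\<lambda>(s, r). B (y - s) * (A (s - r) * F r))"
  proof (rule lborel_pair.Fubini_integrable)
    have "(LINT r|lborel. norm (case (s, r) of (s, r) \<Rightarrow> B (y - s) * (A (s - r) * F r)))
        = \<bar>B (y - s)\<bar> * conv (\<lambda>x. \<bar>A x\<bar>) (\<lambda>x. \<bar>F x\<bar>) s" for s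
      by (simp add: abs_mult conv_def)
    then show "integrable lborel (\<lambda>s. LINT r|lborel. norm (case (s, r) of (s, r) \<Rightarrow> B (y - s) * (A (s - r) * F r)))"
      using conv_integrable[OF causal_kernel_abs[OF B] causal_kernel_conv[OF causal_kernel_abs[OF A] causal_kernel_abs[OF F]]]
      by simp
    show "AE s in lborel. integrable lborel (\<lambda>r. case (s, r) of (s, r) \<Rightarrow> B (y - s) * (A (s - r) * F r))"
      by (simp add: conv_integrable[OF A F])
  qed measurable
  have "conv B (conv A F) y = (LINT s|lborel. LINT r|lborel. B (y - s) * (A (s - r) * F r))"
    by (simp add: conv_def)
  also have "\<dots> = (LINT r|lborel. LINT s|lborel. B (y - s) * (A (s - r) * F r))"
    using lborel_pair.Fubini_integral[OF int] by simp
  also have "\<dots> = (LINT r|lborel. conv A B (y - r) * F r)"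
  proof (rule Bochner_Integration.integral_cong[OF refl])
    fix r
    have "(LINT s|lborel. B (y - s) * (A (s - r) * F r)) = (LINT s|lborel. B (y - s) * A (s - r)) * F r"
      by (simp flip: mult.assoc)
    \<comment> \<open>Substitution \<open>s = y - t\<close>, which exchanges the roles of the two
      kernels.\<close>
    also have "(LINT s|lborel. B (y - s) * A (s - r)) = (LINT t|lborel. A (y - r - t) * B t)"
      by (subst lborel_integral_real_affine[of "-1" _ y]) (simp_all add: algebra_simps)
    finally show "(LINT s|lborel. B (y - s) * (A (s - r) * F r)) = conv A B (y - r) * F r"
      by (simp add: conv_def)
  qed
  finally show ?thesis by (simp add: conv_def)
qed

text \<open>After reassociation the factor \<open>conv A B (y - s)\<close> is 1 for
  \<open>0 < s < y\<close>, because then \<open>y - s\<close> lies in (0, T]; elsewhere one of the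
  two factors vanishes. Convolution with 1 is integration.\<close>

lemma conv_sonin:
  assumes A: "causal_kernel A" and B: "causal_kernel B" and F: "causal_kernel F"
    and one: "\<And>z. 0 < z \<Longrightarrow> z \<le> T \<Longrightarrow> conv A B z = 1" and "y \<le> T"
  shows "conv B (conv A F) y = (LINT s:{0<..<y}|lborel. F s)"
  unfolding conv_assoc[OF A B F] set_lebesgue_integral_def conv_def[of "conv A B"]
proof (rule Bochner_Integration.integral_cong[OF refl])
  fix s
  consider "s \<le> 0" | "y \<le> s" | "0 < s" "s < y" by linarith
  then show "conv A B (y - s) * F s = indicat_real {0<..<y} s *\<^sub>R F s"
    using causal_kernel_nonpos[OF F, of s] causal_kernel_nonpos[OF causal_kernel_conv[OF A B], of "y - s"]
      one[of "y - s"] \<open>y \<le> T\<close>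
    by cases auto
qed

text \<open>Continuity on the half-open interval bounds \<open>f\<close> on each compact {d..L}; the
  cut-off takes care of the rest.\<close>

lemma causal_kernel_restrict:
  assumes cont: "continuous_on {0<..L} f" and int: "set_integrable lborel {0<..L} f"
  shows "causal_kernel (\<lambda>x. indicator {0<..L} x * f x)"
  unfolding causal_kernel_def
proof (intro conjI allI impI)
  show "integrable lborel (\<lambda>x. indicator {0<..L} x * f x)"
    using int by (simp add: set_integrable_def)
next
  fix d :: real assume "d > 0"
  then have "compact (f ` {d..L})"
    by (intro compact_continuous_image continuous_on_subset[OF cont]) auto
  then obtain C where "\<forall>x\<in>{d..L}. \<bar>f x\<bar> \<le> C"
    by (metis compact_imp_bounded bounded_iff imageI real_norm_def)
  then have "\<bar>indicator {0<..L} x * f x\<bar> \<le> max 0 C" if "x \<ge> d" for x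
    using that by (auto simp: indicator_def le_max_iff_disj)
  then show "\<exists>C. \<forall>x\<ge>d. \<bar>indicator {0<..L} x * f x\<bar> \<le> C" by blast
qed simp

section \<open>Kernels of class \<open>C_minus1\<close> and Sonin pairs\<close>

lemma C_minus1_continuous:
  assumes "F \<in> C_minus1 T"
  shows "continuous_on {0<..T} F"
proof -
  obtain p G where G: "continuous_on {0..T} G" and F: "\<forall>x\<in>{0<..T}. F x = x powr p * G x"
    using assms by (auto simp: C_minus1_def)
  have "continuous_on {0<..T} (\<lambda>x. x powr p * G x)"
    by (intro continuous_intros continuous_on_subset[OF G]) auto
  then show ?thesis using F by (subst continuous_on_cong[OF refl]) auto
qed

lemma C_minus1_integrable:
  assumes "F \<in> C_minus1 T"
  shows "set_integrable lborel {0<..T} F"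
proof (cases "0 \<le> T")
  case True
  obtain p G where p: "p > -1" and G: "continuous_on {0..T} G" and F: "\<forall>x\<in>{0<..T}. F x = x powr p * G x"
    using assms by (auto simp: C_minus1_def)
  obtain C where C: "\<forall>x\<in>{0..T}. \<bar>G x\<bar> \<le> C"
    by (metis compact_continuous_image[OF G] compact_Icc compact_imp_bounded bounded_iff imageI real_norm_def)
  have "(\<lambda>x. x powr p) absolutely_integrable_on {0<..T}"
    by (intro nonnegative_absolutely_integrable_1 integrable_on_powr_from_0' p True) auto
  then have "set_integrable lebesgue {0<..T} (\<lambda>x. C * x powr p)"
    by simp
  then have *: "set_integrable lborel {0<..T} (\<lambda>x. C * x powr p)"
    unfolding set_integrable_def by (subst (asm) integrable_completion) auto
  show ?thesis
  proof (rule set_integrable_bound[OF *])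
    show "set_borel_measurable lborel {0<..T} F"
      using borel_measurable_continuous_on_indicator[OF _ C_minus1_continuous[OF assms]]
      by (simp add: set_borel_measurable_def)
    have "norm (F x) \<le> norm (C * x powr p)" if "x \<in> {0<..T}" for x
    proof -
      have "\<bar>G x\<bar> \<le> C" using C that by simp
      then have "\<bar>G x\<bar> \<le> \<bar>C\<bar>" by linarith
      then show ?thesis using F that by (simp add: abs_mult mult.commute mult_right_mono)
    qed
    then show "AE x in lborel. x \<in> {0<..T} \<longrightarrow> norm (F x) \<le> norm (C * x powr p)" by simp
  qed
qed (simp add: set_integrable_def)

lemma causal_kernel_C_minus1:
  "F \<in> C_minus1 T \<Longrightarrow> causal_kernel (\<lambda>x. indicator {0<..T} x * F x)"
  by (intro causal_kernel_restrict C_minus1_continuous C_minus1_integrable)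

text \<open>For \<open>0 < z < x \<le> T\<close> both \<open>z\<close> and \<open>x - z\<close> lie
  in (0, T], so cutting the kernels off at \<open>T\<close> does not change the Sonin
  integral.\<close>

lemma conv_luchko:
  assumes "(M, K) \<in> luchko_set T" "0 < x" "x \<le> T"
  shows "conv (\<lambda>x. indicator {0<..T} x * M x) (\<lambda>x. indicator {0<..T} x * K x) x = 1"
proof -
  have "conv (\<lambda>x. indicator {0<..T} x * M x) (\<lambda>x. indicator {0<..T} x * K x) x
      = (LINT z:{0<..<x}|lborel. M (x - z) * K z)"
    unfolding conv_def set_lebesgue_integral_def using assms(2,3)
    by (intro Bochner_Integration.integral_cong refl) (auto simp: indicator_def)
  then show ?thesis using assms by (simp add: luchko_set_def)
qed

section \<open>Change of variables\<close>

lemma set_integrable_lborel_iff: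
  fixes f :: "real \<Rightarrow> real"
  assumes "set_borel_measurable borel S f"
  shows "set_integrable lborel S f \<longleftrightarrow> f absolutely_integrable_on S"
  using assms by (simp add: set_integrable_def set_borel_measurable_def integrable_completion)

text \<open>The change of variables for absolutely integrable functions, carried over to
  \<open>lborel\<close>; the measurability hypotheses serve this transfer.\<close>

lemma set_integral_substitution:
  fixes h h' H :: "real \<Rightarrow> real"
  assumes S: "S \<in> sets borel"
    and der: "\<And>u. u \<in> S \<Longrightarrow> (h has_real_derivative h' u) (at u within S)"
    and inj: "inj_on h S"
    and meas: "set_borel_measurable borel S (\<lambda>u. H (h u) * \<bar>h' u\<bar>)"
      "set_borel_measurable borel (h ` S) H"
  shows "set_integrable lborel S (\<lambda>u. H (h u) * \<bar>h' u\<bar>) \<longleftrightarrow> set_integrable lborel (h ` S) H"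
    and "set_integrable lborel (h ` S) H \<Longrightarrow>
      (LINT u:S|lborel. H (h u) * \<bar>h' u\<bar>) = (LINT s:h ` S|lborel. H s)"
proof -
  have "S \<in> sets lebesgue" using S by simp
  note * = has_absolute_integral_change_of_variables_1'[OF this der inj, of H]
  \<comment> \<open>Each equivalence in \<open>*\<close> speaks of integrability together with a
    prescribed value. Prescribing the integral of either side in turn yields both
    implications.\<close>
  have abs_iff: "(\<lambda>u. \<bar>h' u\<bar> * H (h u)) absolutely_integrable_on S \<longleftrightarrow> H absolutely_integrable_on h ` S"
    using *[of "integral S (\<lambda>u. \<bar>h' u\<bar> * H (h u))"] *[of "integral (h ` S) H"] by blast
  show iff: "set_integrable lborel S (\<lambda>u. H (h u) * \<bar>h' u\<bar>) \<longleftrightarrow> set_integrable lborel (h ` S) H"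
    using abs_iff meas by (simp add: set_integrable_lborel_iff mult.commute)
  assume H: "set_integrable lborel (h ` S) H"
  then have "set_integrable lborel S (\<lambda>u. H (h u) * \<bar>h' u\<bar>)" using iff by blast
  then show "(LINT u:S|lborel. H (h u) * \<bar>h' u\<bar>) = (LINT s:h ` S|lborel. H s)"
    using * H meas
    by (simp add: set_borel_integral_eq_integral(2) set_integrable_lborel_iff mult.commute)
qed

text \<open>Mean value theorem on {u..v}. Derivatives are taken within \<open>S\<close>, so a
  one-sided one is enough at an endpoint that belongs to \<open>S\<close>.\<close>

lemma increasing_on_interval:
  fixes P :: "real \<Rightarrow> real"
  assumes S: "is_interval S"
    and der: "\<And>u. u \<in> S \<Longrightarrow> (P has_real_derivative D u) (at u within S)"
    and pos: "\<And>u. u \<in> S \<Longrightarrow> D u > 0"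
  shows "strict_mono_on S P"
proof (rule strict_mono_onI)
  fix u v assume uv: "u \<in> S" "v \<in> S" "u < v"
  then have sub: "{u..v} \<subseteq> S"
    using S unfolding is_interval_1 by (meson atLeastAtMost_iff subsetI)
  obtain x where x: "x \<in> {u<..<v}" "P v - P u = D x * (v - u)"
  proof -
    have "(P has_derivative (*) (D x)) (at x within {u..v})" if "u \<le> x" "x \<le> v" for x
      using DERIV_subset[OF der sub, of x] sub that by (auto simp: has_field_derivative_def)
    from mvt_simple[OF \<open>u < v\<close> this] show thesis using that by blast
  qed
  then have "D x > 0" using pos sub by (simp add: subset_iff)
  then have "D x * (v - u) > 0" using uv by simp
  then show "P u < P v" using x(2) by linarith
qed

text \<open>The constant 1 is integrable on the bounded interval \<open>P ` S\<close>; substitute \<open>P\<close>.\<close>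

lemma derivative_absolutely_integrable:
  fixes P D :: "real \<Rightarrow> real"
  assumes S: "is_interval S"
    and der: "\<And>u. u \<in> S \<Longrightarrow> (P has_real_derivative D u) (at u within S)"
    and inj: "inj_on P S" and bdd: "bounded (P ` S)"
  shows "(\<lambda>u. \<bar>D u\<bar>) absolutely_integrable_on S"
proof -
  have "S \<in> sets lebesgue" using real_interval_borel_measurable[OF S] by simp
  have "continuous_on S P"
    using der by (rule DERIV_continuous_on)
  then have "is_interval (P ` S)"
    using S by (simp add: is_interval_connected_1 connected_continuous_image)
  then have "P ` S \<in> lmeasurable"
    using real_interval_borel_measurable by (intro bounded_set_imp_lmeasurable bdd) simp
  then have "(\<lambda>_. 1 :: real) absolutely_integrable_on (P ` S)"
    using absolutely_integrable_on_const by blast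
  then show ?thesis
    using has_absolute_integral_change_of_variables_1'[OF \<open>S \<in> sets lebesgue\<close> der inj,
        of "\<lambda>_. 1" "integral (P ` S) (\<lambda>_. 1)"]
    by simp
qed

text \<open>
  With \<open>\<sigma> = 1\<close> and \<open>S = {a<..b}\<close> the locale describes the left-sided setting, with \<open>\<sigma> = -1\<close>
  and \<open>S = {a..<b}\<close> the right-sided one.
\<close>

locale oriented_interval =
  fixes S :: "real set" and \<sigma> e :: real and g g' :: "real \<Rightarrow> real"
  assumes interval: "is_interval S" and bounded: "bounded S"
    and sign: "\<sigma> = 1 \<or> \<sigma> = -1"
    and last: "e \<in> S" "\<And>u. u \<in> S \<Longrightarrow> \<sigma> * u \<le> \<sigma> * e"
    and no_first: "\<And>u. u \<in> S \<Longrightarrow> \<exists>v\<in>S. \<sigma> * v < \<sigma> * u"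
    and mono: "strict_mono_on S g"
    and deriv: "\<And>u. u \<in> S \<Longrightarrow> (g has_real_derivative g' u) (at u within S)"
    and deriv_pos: "\<And>u. u \<in> S \<Longrightarrow> g' u > 0"
    and deriv_cont: "continuous_on S g'"
    and bdd: "bdd_below ((\<lambda>u. \<sigma> * g u) ` S)"
begin

section \<open>The coordinate \<open>h\<close> on an oriented interval\<close>

text \<open>The infimum over \<open>S\<close> is the one-sided limit of \<open>\<sigma> * g\<close>
  at the excluded endpoint. Subtracting it, rather than the value there, makes the image start at 0
  even if \<open>g\<close> jumps.\<close>

definition h :: "real \<Rightarrow> real" where
  "h u = \<sigma> * g u - (INF v\<in>S. \<sigma> * g v)"

abbreviation before :: "real \<Rightarrow> real set" where
  "before x \<equiv> {u \<in> S. \<sigma> * u < \<sigma> * x}"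

text \<open>The right-hand side is the kernel argument of both operators, \<open>g x - g u\<close>
  on the left and \<open>g u - g x\<close> on the right; the infimum cancels.\<close>

lemma h_diff: "h x - h u = \<sigma> * (g x - g u)"
  by (simp add: h_def algebra_simps)

lemma S_borel: "S \<in> sets borel"
  by (rule real_interval_borel_measurable[OF interval])

lemma before_borel: "before x \<in> sets borel"
proof -
  have "before x = S \<inter> {u. \<sigma> * u < \<sigma> * x}" by auto
  then show ?thesis using S_borel by simp
qed

lemma h_less_iff: "u \<in> S \<Longrightarrow> v \<in> S \<Longrightarrow> h u < h v \<longleftrightarrow> \<sigma> * u < \<sigma> * v"
  using sign strict_mono_on_less[OF mono] by (auto simp: h_def)

lemma h_inj: "inj_on h S"
  using sign strict_mono_on_eqD[OF mono] by (auto simp: h_def inj_on_def)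

lemma h_deriv: "u \<in> S \<Longrightarrow> (h has_real_derivative \<sigma> * g' u) (at u within S)"
  unfolding h_def by (auto intro!: derivative_eq_intros deriv)

lemma h_abs_deriv: "u \<in> S \<Longrightarrow> \<bar>\<sigma> * g' u\<bar> = g' u"
  using sign deriv_pos[of u] by (auto simp: abs_mult)

lemma h_cont: "continuous_on S h"
  using h_deriv by (rule DERIV_continuous_on)

lemma h_pos: "u \<in> S \<Longrightarrow> h u > 0"
proof -
  assume u: "u \<in> S"
  then obtain v where v: "v \<in> S" "\<sigma> * v < \<sigma> * u" using no_first by blast
  then have "h v < h u" using h_less_iff u by blast
  moreover have "0 \<le> h v" using cINF_lower[OF bdd v(1)] by (simp add: h_def)
  ultimately show ?thesis by simp
qed

text \<open>Used with \<open>m\<close> the value of \<open>\<sigma> * g\<close> at the excluded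
  endpoint, to compare \<open>h\<close> with the differences in the definitions of the function
  classes.\<close>

lemma h_le: "(\<And>v. v \<in> S \<Longrightarrow> m \<le> \<sigma> * g v) \<Longrightarrow> h u \<le> \<sigma> * g u - m"
  using cINF_greatest[of S m "\<lambda>v. \<sigma> * g v"] last(1) by (fastforce simp: h_def)

lemma h_le_last: "u \<in> S \<Longrightarrow> h u \<le> h e"
  using h_less_iff[of e u] last by (meson not_less)

text \<open>The infimum provides values of \<open>h\<close> below any \<open>y > 0\<close>, the last
  point \<open>e\<close> provides the maximum, and connectedness fills the gap.\<close>

lemma h_image: "h ` S = {0<..h e}"
proof (intro equalityI subsetI)
  fix y assume "y \<in> h ` S"
  then show "y \<in> {0<..h e}" using h_pos h_le_last by auto
next
  fix y assume y: "y \<in> {0<..h e}"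
  have "\<exists>v\<in>S. \<sigma> * g v < (INF v\<in>S. \<sigma> * g v) + y"
    using cINF_less_iff[OF _ bdd, of "(INF v\<in>S. \<sigma> * g v) + y"] last(1) y by auto
  then obtain v where v: "v \<in> S" "h v < y" by (auto simp: h_def)
  have "is_interval (h ` S)"
    using interval h_cont by (simp add: is_interval_connected_1 connected_continuous_image)
  then show "y \<in> h ` S"
    using imageI[OF v(1), of h] imageI[OF last(1), of h] v(2) y unfolding is_interval_1
    by (meson greaterThanAtMost_iff less_imp_le)
qed

lemma h_before: "x \<in> S \<Longrightarrow> h ` before x = {0<..<h x}"
proof (intro equalityI subsetI)
  fix y assume "x \<in> S" "y \<in> h ` before x"
  then show "y \<in> {0<..<h x}" using h_pos h_less_iff by auto
next
  fix y assume x: "x \<in> S" and y: "y \<in> {0<..<h x}"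
  then have "y \<in> h ` S" using h_le_last[OF x] by (auto simp: h_image)
  then show "y \<in> h ` before x" using h_less_iff x y by auto
qed

text \<open>A continuous injection of an interval into the line is a homeomorphism onto its
  image.\<close>

lemma inv_h_cont: "continuous_on {0<..h e} (inv_into S h)"
proof -
  have "path_connected S" using interval by (simp add: is_interval_path_connected)
  then obtain k where k: "homeomorphism S (h ` S) h k"
    using injective_into_1d_eq_homeomorphism[OF h_cont] h_inj by blast
  then have "inv_into S h y = k y" if "y \<in> h ` S" for y
    using that h_inj by (auto simp: homeomorphism_def)
  then show ?thesis
    using homeomorphism_cont2[OF k] by (subst continuous_on_cong[OF h_image[symmetric]]) auto
qed

lemma h_measurable [measurable]: "h \<in> borel_measurable (restrict_space borel S)"
  and g'_measurable [measurable]: "g' \<in> borel_measurable (restrict_space borel S)"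
  using borel_measurable_continuous_on_restrict h_cont deriv_cont by blast+

text \<open>Nothing is known about \<open>g\<close> and \<open>g'\<close> outside \<open>S\<close>,
  so measurability is first shown on the restricted space and then extended by zero.\<close>

lemma substitution_measurable:
  assumes T: "T \<in> sets borel" "T \<subseteq> S" and [measurable]: "H \<in> borel_measurable borel"
  shows "set_borel_measurable borel T (\<lambda>u. H (h u) * g' u)"
proof -
  have "(\<lambda>u. H (h u) * g' u) \<in> borel_measurable (restrict_space borel S)" by measurable
  then have "set_borel_measurable borel S (\<lambda>u. H (h u) * g' u)"
    using S_borel by (subst (asm) borel_measurable_restrict_space_iff) (auto simp: set_borel_measurable_def)
  then show ?thesis using T set_borel_measurable_subset by blast
qed

text \<open>Since \<open>\<bar>\<sigma> * g' u\<bar> = g' u\<close>, both orientations obey the same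
  formula.\<close>

lemma substitution:
  assumes T: "T \<in> sets borel" "T \<subseteq> S" "h ` T \<in> sets borel" and H: "H \<in> borel_measurable borel"
  shows "set_integrable lborel T (\<lambda>u. H (h u) * g' u) \<longleftrightarrow> set_integrable lborel (h ` T) H"
    and "set_integrable lborel (h ` T) H \<Longrightarrow>
      (LINT u:T|lborel. H (h u) * g' u) = (LINT s:h ` T|lborel. H s)"
proof -
  have eq: "H (h u) * \<bar>\<sigma> * g' u\<bar> = H (h u) * g' u" if "u \<in> T" for u
    using h_abs_deriv T(2) that by auto
  have der: "(h has_real_derivative \<sigma> * g' u) (at u within T)" if "u \<in> T" for u
    using h_deriv T(2) that DERIV_subset by blast
  have inj: "inj_on h T" using h_inj T(2) inj_on_subset by blast
  have "set_borel_measurable borel T (\<lambda>u. H (h u) * \<bar>\<sigma> * g' u\<bar>)"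
    using substitution_measurable[OF T(1,2) H] eq
    unfolding set_borel_measurable_def
    by (subst measurable_cong[where g = "\<lambda>u. indicator T u *\<^sub>R (H (h u) * g' u)"])
      (simp_all add: indicator_def)
  moreover have "set_borel_measurable borel (h ` T) H"
    using T(3) H by (simp add: set_borel_measurable_def)
  ultimately have *: "set_integrable lborel T (\<lambda>u. H (h u) * \<bar>\<sigma> * g' u\<bar>) \<longleftrightarrow> set_integrable lborel (h ` T) H"
    "set_integrable lborel (h ` T) H \<Longrightarrow>
      (LINT u:T|lborel. H (h u) * \<bar>\<sigma> * g' u\<bar>) = (LINT s:h ` T|lborel. H s)"
    using set_integral_substitution[OF T(1) der inj, of H] by blast+
  show "set_integrable lborel T (\<lambda>u. H (h u) * g' u) \<longleftrightarrow> set_integrable lborel (h ` T) H"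
    unfolding *(1)[symmetric] by (rule set_integrable_cong) (simp_all add: eq)
  show "(LINT u:T|lborel. H (h u) * g' u) = (LINT s:h ` T|lborel. H s)" if "set_integrable lborel (h ` T) H"
    unfolding *(2)[OF that, symmetric] using T(1)
    by (intro set_lebesgue_integral_cong) (simp_all add: eq)
qed

section \<open>The operators as convolutions\<close>

text \<open>This is \<open>f \<circ> h\<^sup>-\<^sup>1\<close>; the indicator hides the arbitrary
  values of \<open>inv_into\<close> outside the image of \<open>h\<close>.\<close>

definition pullback :: "(real \<Rightarrow> real) \<Rightarrow> real \<Rightarrow> real" where
  "pullback f s = indicator {0<..h e} s * f (inv_into S h s)"

lemma pullback_h: "u \<in> S \<Longrightarrow> pullback f (h u) = f u"
  using h_pos[of u] h_le_last[of u] h_inj by (simp add: pullback_def)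

text \<open>Substituting \<open>s = h u\<close> identifies integrability of the pullback with that
  of \<open>f u * g' u\<close>, hence the form of the hypothesis.\<close>

lemma causal_kernel_pullback:
  assumes f: "continuous_on S f" and int: "set_integrable lborel S (\<lambda>u. f u * g' u)"
  shows "causal_kernel (pullback f)" "continuous_on {0<..h e} (pullback f)"
proof -
  have cont: "continuous_on {0<..h e} (\<lambda>s. f (inv_into S h s))"
    by (rule continuous_on_compose2[OF f inv_h_cont]) (auto simp: h_image[symmetric] inv_into_into)
  then show "continuous_on {0<..h e} (pullback f)"
    by (subst continuous_on_cong[OF refl]) (auto simp: pullback_def)
  have meas: "pullback f \<in> borel_measurable borel"
    using borel_measurable_continuous_on_indicator[OF _ cont] by (simp add: pullback_def[abs_def])
  have "set_integrable lborel S (\<lambda>u. pullback f (h u) * g' u)"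
    using int by (subst set_integrable_cong[OF refl refl]) (auto simp: pullback_h)
  then have "set_integrable lborel {0<..h e} (pullback f)"
    using substitution(1)[OF S_borel order_refl _ meas] by (simp add: h_image)
  then have "set_integrable lborel {0<..h e} (\<lambda>s. f (inv_into S h s))"
    by (subst set_integrable_cong[OF refl refl]) (auto simp: pullback_def)
  then show "causal_kernel (pullback f)"
    unfolding pullback_def[abs_def] by (rule causal_kernel_restrict[OF cont])
qed

text \<open>The common form of \<open>gfi_left\<close> (\<open>\<sigma> = 1\<close>) and
  \<open>gfi_right\<close> (\<open>\<sigma> = -1\<close>).\<close>

definition gfi :: "(real \<Rightarrow> real) \<Rightarrow> (real \<Rightarrow> real) \<Rightarrow> real \<Rightarrow> real" where
  "gfi N f x = (LINT u:before x|lborel. N (\<sigma> * (g x - g u)) * f u * g' u)"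

text \<open>Stated for any causal \<open>F\<close> that represents \<open>f\<close> in the
  coordinate \<open>h\<close>, so that it applies twice: to the pullback of \<open>f\<close>, then
  to its convolution with the first kernel.\<close>

lemma gfi_eq_conv:
  assumes A: "causal_kernel A" and F: "causal_kernel F"
    and AN: "\<And>s. 0 < s \<Longrightarrow> s \<le> h e \<Longrightarrow> A s = N s" and Ff: "\<And>u. u \<in> S \<Longrightarrow> F (h u) = f u"
    and x: "x \<in> S"
  shows "set_integrable lborel (before x) (\<lambda>u. N (\<sigma> * (g x - g u)) * f u * g' u)"
    and "gfi N f x = conv A F (h x)"
proof -
  note [measurable] = causal_kernel_measurable[OF A] causal_kernel_measurable[OF F]
  let ?H = "\<lambda>s. A (h x - s) * F s"
  have eq: "?H (h u) * g' u = N (\<sigma> * (g x - g u)) * f u * g' u" if "u \<in> before x" for u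
  proof -
    have "0 < h x - h u" "h x - h u \<le> h e"
      using that h_less_iff[of u x] h_pos[of u] h_le_last[OF x] x by auto
    then show ?thesis using AN Ff[of u] that by (simp add: h_diff)
  qed
  have H: "?H \<in> borel_measurable borel" by measurable
  \<comment> \<open>Causality of both factors makes the restriction to (0, h x) automatic.\<close>
  have zero: "indicat_real {0<..<h x} s *\<^sub>R ?H s = ?H s" for s
    using causal_kernel_nonpos[OF A, of "h x - s"] causal_kernel_nonpos[OF F, of s]
    by (cases "s \<le> 0"; cases "h x \<le> s") (simp_all add: indicator_def)
  have "set_integrable lborel {0<..<h x} ?H"
    unfolding set_integrable_def zero by (rule conv_integrable[OF A F])
  then have int: "set_integrable lborel (h ` before x) ?H" by (simp add: h_before x)
  have sub: "before x \<subseteq> S" "h ` before x \<in> sets borel" by (auto simp: h_before x)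
  show "set_integrable lborel (before x) (\<lambda>u. N (\<sigma> * (g x - g u)) * f u * g' u)"
  proof -
    have "set_integrable lborel (before x) (\<lambda>u. ?H (h u) * g' u)"
      using substitution(1)[OF before_borel sub H] int by blast
    then show ?thesis by (subst set_integrable_cong[OF refl refl eq[symmetric]])
  qed
  have "gfi N f x = (LINT u:before x|lborel. ?H (h u) * g' u)"
    unfolding gfi_def using before_borel[of x]
    by (intro set_lebesgue_integral_cong allI impI eq[symmetric]) simp_all
  also have "\<dots> = (LINT s:{0<..<h x}|lborel. ?H s)"
    using substitution(2)[OF before_borel sub H int] by (simp add: h_before x)
  also have "\<dots> = conv A F (h x)"
    unfolding set_lebesgue_integral_def zero conv_def ..
  finally show "gfi N f x = conv A F (h x)" .
qed

text \<open>Fundamental theorem of calculus at \<open>h x > 0\<close>, followed by the chain rule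
  with derivative \<open>\<sigma> * g'\<close> of \<open>h\<close>.\<close>

lemma integral_pullback_deriv:
  assumes F: "causal_kernel F" "continuous_on {0<..h e} F" and x: "x \<in> S"
  shows "((\<lambda>x. LINT s:{0<..<h x}|lborel. F s) has_real_derivative F (h x) * (\<sigma> * g' x)) (at x within S)"
proof -
  have int: "set_integrable lborel A F" if "A \<in> sets borel" for A
    using causal_kernel_integrable[OF F(1)] that set_integrable_subset[of lborel UNIV F A]
    by (simp add: set_integrable_def)
  have eq: "(LINT s:{0<..<y}|lborel. F s) = integral {0..y} F" for y
    using set_borel_integral_eq_integral(2)[OF int, of "{0<..<y}"]
    by (simp add: integral_open_interval_real)
  have "continuous (at (h x) within {0..h e}) F"
  proof -
    \<comment> \<open>\<open>F\<close> is continuous only on the interval without 0, while the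
      fundamental theorem is applied on the closed one; near \<open>h x > 0\<close> the two
      coincide.\<close>
    have "at (h x) within {0..h e} = at (h x) within {0<..h e}"
      using h_pos[OF x] by (intro at_within_nhd[of _ "{0<..}"]) auto
    moreover have "continuous (at (h x) within {0<..h e}) F"
      using F(2) h_pos[OF x] h_le_last[OF x] by (auto simp: continuous_on_eq_continuous_within)
    ultimately show ?thesis by simp
  qed
  then have "((\<lambda>y. integral {0..y} F) has_real_derivative F (h x)) (at (h x) within {0..h e})"
    using integral_has_vector_derivative_continuous_at[of F 0 "h e" "h x" "{}"]
      set_borel_integral_eq_integral(1)[OF int, of "{0..h e}"] h_pos[OF x] h_le_last[OF x]
    by (simp add: has_real_derivative_iff_has_vector_derivative)
  then have "((\<lambda>y. integral {0..y} F) has_real_derivative F (h x)) (at (h x) within h ` S)"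
    by (rule DERIV_subset) (auto simp: h_image)
  from DERIV_image_chain[OF this h_deriv[OF x]] show ?thesis
    by (simp add: eq o_def)
qed

text \<open>Both operators become convolutions, and \<open>conv_sonin\<close> collapses their
  composition to the integral of the pullback up to \<open>h x\<close>. As kernel arguments stay
  within (0, h e], \<open>h e \<le> T\<close> makes the cut-offs harmless.\<close>

lemma gfi_gfi:
  assumes MK: "(M, K) \<in> luchko_set T" and T: "h e \<le> T"
    and f: "continuous_on S f" "set_integrable lborel S (\<lambda>u. f u * g' u)" and x: "x \<in> S"
  shows "set_integrable lborel (before x) (\<lambda>u. M (\<sigma> * (g x - g u)) * f u * g' u)"
    and "set_integrable lborel (before x) (\<lambda>u. K (\<sigma> * (g x - g u)) * gfi M f u * g' u)"
    and "(gfi K (gfi M f) has_real_derivative \<sigma> * f x * g' x) (at x within S)"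
proof -
  let ?A = "\<lambda>x. indicator {0<..T} x * M x" and ?B = "\<lambda>x. indicator {0<..T} x * K x"
  have A: "causal_kernel ?A" and B: "causal_kernel ?B"
    using MK by (auto simp: luchko_set_def intro: causal_kernel_C_minus1)
  have AM: "?A s = M s" and BK: "?B s = K s" if "0 < s" "s \<le> h e" for s
    using that T by auto
  note F = causal_kernel_pullback[OF f]
  show "set_integrable lborel (before x) (\<lambda>u. M (\<sigma> * (g x - g u)) * f u * g' u)"
    by (rule gfi_eq_conv(1)[OF A F(1) _ pullback_h x]) (simp_all add: AM)
  have M: "conv ?A (pullback f) (h u) = gfi M f u" if "u \<in> S" for u
    by (rule gfi_eq_conv(2)[OF A F(1) _ pullback_h that, symmetric]) (simp_all add: AM)
  show "set_integrable lborel (before x) (\<lambda>u. K (\<sigma> * (g x - g u)) * gfi M f u * g' u)"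
    by (rule gfi_eq_conv(1)[OF B causal_kernel_conv[OF A F(1)] _ M x]) (simp_all add: BK)
  have K: "gfi K (gfi M f) u = conv ?B (conv ?A (pullback f)) (h u)" if "u \<in> S" for u
    by (rule gfi_eq_conv(2)[OF B causal_kernel_conv[OF A F(1)] _ M that]) (simp_all add: BK)
  have "gfi K (gfi M f) u = (LINT s:{0<..<h u}|lborel. pullback f s)" if "u \<in> S" for u
    unfolding K[OF that]
    by (rule conv_sonin[OF A B F(1), of T]) (use conv_luchko[OF MK] h_le_last[OF that] T in auto)
  then show "(gfi K (gfi M f) has_real_derivative \<sigma> * f x * g' x) (at x within S)"
    using has_field_derivative_transform_within[OF integral_pullback_deriv[OF F x] zero_less_one x] x
    by (simp add: pullback_h mult_ac)
qed

section \<open>Integrability at the excluded endpoint\<close>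

text \<open>
  With \<open>w = sqrt (1 + f\<^sup>2)\<close>, so that \<open>\<bar>w'\<bar> \<le> \<bar>f'\<bar>\<close>, the function \<open>w h + \<sigma> C u\<close> is monotone
  and bounded, and its derivative dominates \<open>\<bar>f\<bar> g'\<close>.
\<close>

lemma weighted_integrable:
  assumes f: "\<And>u. u \<in> S \<Longrightarrow> (f has_real_derivative f' u) (at u within S)"
    and C: "\<And>u. u \<in> S \<Longrightarrow> \<bar>f' u\<bar> * h u \<le> C"
  shows "set_integrable lborel S (\<lambda>u. f u * g' u)"
proof -
  define w where "w u = sqrt (1 + (f u)\<^sup>2)" for u
  define P where "P u = w u * h u + \<sigma> * C * u" for u
  define D where "D u = f u * f' u / w u * h u + w u * (\<sigma> * g' u) + \<sigma> * C" for u
  have w_pos: "w u > 0" for u by (simp add: w_def add_pos_nonneg)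
  have w_ge: "\<bar>f u\<bar> \<le> w u" for u unfolding w_def by (rule real_le_rsqrt) simp
  have \<sigma>\<sigma>: "\<sigma> * \<sigma> = 1" and abs\<sigma>: "\<bar>\<sigma>\<bar> = 1" using sign by auto
  have "C \<ge> 0" using C[OF last(1)] h_pos[OF last(1)] by (smt (verit) mult_nonneg_nonneg)
  have P_deriv: "(P has_real_derivative D u) (at u within S)" if "u \<in> S" for u
    unfolding P_def D_def w_def
    using add_pos_nonneg[OF zero_less_one zero_le_power2[of "f u"]]
    by (auto intro!: derivative_eq_intros f[OF that] h_deriv[OF that] simp: field_simps)
  \<comment> \<open>The term from \<open>w'\<close> is at most \<open>C\<close> in absolute value,
    since \<open>\<bar>f u\<bar> \<le> w u\<close>; the summand \<open>\<sigma> * C * u\<close> of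
    \<open>P\<close> was added to absorb it.\<close>
  have D_ge: "w u * g' u \<le> \<sigma> * D u" if "u \<in> S" for u
  proof -
    let ?t = "f u * f' u / w u * h u"
    have "\<bar>?t\<bar> = (\<bar>f u\<bar> / w u) * (\<bar>f' u\<bar> * h u)"
      using w_pos[of u] h_pos[OF that] by (simp add: abs_mult)
    also have "\<dots> \<le> 1 * C"
      using w_pos[of u] w_ge[of u] h_pos[OF that] C[OF that] by (intro mult_mono) auto
    finally have "\<bar>\<sigma> * ?t\<bar> \<le> C" using abs\<sigma> by (simp add: abs_mult)
    moreover have "\<sigma> * D u = \<sigma> * ?t + (\<sigma> * \<sigma>) * (w u * g' u) + (\<sigma> * \<sigma>) * C"
      unfolding D_def by (simp only: algebra_simps)
    then have "\<sigma> * D u = \<sigma> * ?t + w u * g' u + C" by (simp only: \<sigma>\<sigma> mult_1)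
    ultimately show ?thesis by linarith
  qed
  have "\<sigma> * D u > 0" if "u \<in> S" for u
    using D_ge[OF that] mult_pos_pos[OF w_pos deriv_pos[OF that], of u] by linarith
  moreover have "((\<lambda>u. \<sigma> * P u) has_real_derivative \<sigma> * D u) (at u within S)" if "u \<in> S" for u
    using P_deriv[OF that] by (rule DERIV_cmult)
  ultimately have mono: "strict_mono_on S (\<lambda>u. \<sigma> * P u)"
    by (intro increasing_on_interval[OF interval]) auto
  then have inj: "inj_on P S"
    by (auto simp: inj_on_def dest: strict_mono_on_eqD)
  obtain B where B: "\<And>u. u \<in> S \<Longrightarrow> \<bar>u\<bar> \<le> B"
    using bounded by (auto simp: bounded_iff)
  have "C * B \<ge> 0" using \<open>C \<ge> 0\<close> B[OF last(1)] abs_ge_zero order_trans mult_nonneg_nonneg by blast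
  \<comment> \<open>In either orientation \<open>P\<close> is largest at \<open>e\<close>. The
    product \<open>w u * h u\<close> is nonnegative, so only the linear term enters the lower
    bound.\<close>
  have "\<bar>P u\<bar> \<le> \<bar>P e\<bar> + C * B" if "u \<in> S" for u
  proof -
    have "P u \<le> P e"
      using sign last(2)[OF that] last(1) that strict_mono_on_leD[OF mono, of u e]
        strict_mono_on_leD[OF mono, of e u] by auto
    moreover have "- (C * B) \<le> P u"
    proof -
      have "\<bar>\<sigma> * C * u\<bar> \<le> C * B"
        using B[OF that] \<open>C \<ge> 0\<close> by (simp add: abs_mult abs\<sigma> mult_left_mono)
      moreover have "0 \<le> w u * h u" using w_pos[of u] h_pos[OF that] by simp
      ultimately show ?thesis unfolding P_def by linarith
    qed
    ultimately show ?thesis using \<open>C * B \<ge> 0\<close> by linarith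
  qed
  then have "bounded (P ` S)" by (auto simp: bounded_iff)
  then have D_int: "(\<lambda>u. \<bar>D u\<bar>) absolutely_integrable_on S"
    by (intro derivative_absolutely_integrable[OF interval P_deriv inj])
  have "continuous_on S f"
    using f by (rule DERIV_continuous_on)
  then have "continuous_on S (\<lambda>u. f u * g' u)"
    by (intro continuous_intros deriv_cont)
  then have meas: "set_borel_measurable borel S (\<lambda>u. f u * g' u)"
    unfolding set_borel_measurable_def by (rule borel_measurable_continuous_on_indicator[OF S_borel])
  have "norm (f u * g' u) \<le> norm \<bar>D u\<bar>" if "u \<in> S" for u
  proof -
    have "\<bar>f u * g' u\<bar> \<le> w u * g' u"
      using w_ge[of u] deriv_pos[OF that] by (simp add: abs_mult)
    also have "\<dots> \<le> \<bar>\<sigma> * D u\<bar>" using D_ge[OF that] by linarith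
    finally show ?thesis using abs\<sigma> by (simp add: abs_mult)
  qed
  then have "(\<lambda>u. f u * g' u) absolutely_integrable_on S"
    using meas by (intro set_integrable_bound[OF D_int])
      (auto simp: set_borel_measurable_def intro!: measurable_completion)
  then show ?thesis using set_integrable_lborel_iff[OF meas] by blast
qed

end

section \<open>The left- and right-sided operators\<close>

lemma at_within_Icc_neq_bot: "a < b \<Longrightarrow> x \<in> {a..b} \<Longrightarrow> at x within {a..b} \<noteq> bot" for a b x :: real
  by (simp add: trivial_limit_within islimpt_Icc)

lemma strict_mono_on_derivative_nonneg:
  fixes g :: "real \<Rightarrow> real"
  assumes "strict_mono_on S g" "x \<in> S" "at x within S \<noteq> bot"
    and "(g has_real_derivative D) (at x within S)"
  shows "D \<ge> 0"
proof (rule tendsto_lowerbound)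
  show "((\<lambda>y. (g y - g x) / (y - x)) \<longlongrightarrow> D) (at x within S)"
    using assms(4) by (simp add: has_field_derivative_iff)
  have "0 \<le> (g y - g x) / (y - x)" if "y \<in> S" "y \<noteq> x" for y
    using that assms(2) strict_mono_onD[OF assms(1), of x y] strict_mono_onD[OF assms(1), of y x]
    by (cases "x < y") (auto intro!: divide_nonneg_nonneg divide_nonpos_nonpos)
  then show "\<forall>\<^sub>F y in at x within S. 0 \<le> (g y - g x) / (y - x)"
    by (auto simp: eventually_at_filter)
qed (rule assms(3))

text \<open>Monotonicity makes the difference quotients nonnegative, and nonvanishing turns the
  nonnegative limit into a positive one.\<close>

lemma deriv_on_pos:
  assumes ab: "a < b" "x \<in> {a..b}" and g: "strict_mono_on {a..b} g"
    and diff: "g differentiable (at x within {a..b})" and "deriv_on a b g x \<noteq> 0"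
  shows "(g has_real_derivative deriv_on a b g x) (at x within {a..b})" "deriv_on a b g x > 0"
proof -
  show *: "(g has_real_derivative deriv_on a b g x) (at x within {a..b})"
    using vector_derivative_works[THEN iffD1, OF diff]
    by (simp add: has_real_derivative_iff_has_vector_derivative)
  show "deriv_on a b g x > 0"
    using strict_mono_on_derivative_nonneg[OF g ab(2) at_within_Icc_neq_bot[OF ab] *] assms(5) by simp
qed

lemma oriented_interval_left:
  assumes "a < b" "g \<in> G_left a b"
  shows "oriented_interval {a<..b} 1 b g (deriv_on a b g)"
proof -
  have g: "strict_mono_on {a..b} g" "continuous_on {a<..b} (deriv_on a b g)"
    "\<And>x. x \<in> {a<..b} \<Longrightarrow> g differentiable (at x within {a..b})"
    "\<And>x. x \<in> {a<..b} \<Longrightarrow> deriv_on a b g x \<noteq> 0"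
    using assms(2) by (auto simp: G_left_def)
  note d = deriv_on_pos[OF assms(1) _ g(1,3,4)]
  show ?thesis
  proof
    show "\<exists>v\<in>{a<..b}. 1 * v < 1 * u" if "u \<in> {a<..b}" for u
      using that by (intro bexI[of _ "(a + u) / 2"]) auto
    show "strict_mono_on {a<..b} g"
      using g(1) by (auto simp: monotone_on_def)
    show "(g has_real_derivative deriv_on a b g u) (at u within {a<..b})" if "u \<in> {a<..b}" for u
      using d(1)[of u] that by (auto intro: DERIV_subset)
    show "bdd_below ((\<lambda>u. 1 * g u) ` {a<..b})"
      using strict_mono_on_leD[OF g(1), of a] assms(1) by (intro bdd_belowI2[of _ "g a"]) auto
  qed (use assms(1) d(2) g(2) in \<open>auto simp: is_interval_oc\<close>)
qed

lemma oriented_interval_right: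
  assumes "a < b" "g \<in> G_right a b"
  shows "oriented_interval {a..<b} (-1) a g (deriv_on a b g)"
proof -
  have g: "strict_mono_on {a..b} g" "continuous_on {a..<b} (deriv_on a b g)"
    "\<And>x. x \<in> {a..<b} \<Longrightarrow> g differentiable (at x within {a..b})"
    "\<And>x. x \<in> {a..<b} \<Longrightarrow> deriv_on a b g x \<noteq> 0"
    using assms(2) by (auto simp: G_right_def)
  note d = deriv_on_pos[OF assms(1) _ g(1,3,4)]
  show ?thesis
  proof
    show "\<exists>v\<in>{a..<b}. - 1 * v < - 1 * u" if "u \<in> {a..<b}" for u
      using that by (intro bexI[of _ "(u + b) / 2"]) auto
    show "strict_mono_on {a..<b} g"
      using g(1) by (auto simp: monotone_on_def)
    show "(g has_real_derivative deriv_on a b g u) (at u within {a..<b})" if "u \<in> {a..<b}" for u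
      using d(1)[of u] that by (auto intro: DERIV_subset)
    show "bdd_below ((\<lambda>u. - 1 * g u) ` {a..<b})"
      using strict_mono_on_leD[OF g(1), of _ b] assms(1) by (intro bdd_belowI2[of _ "- g b"]) auto
  qed (use assms(1) d(2) g(2) in \<open>auto simp: is_interval_co\<close>)
qed

text \<open>Here \<open>t\<close> is the difference of \<open>g\<close> values in the derivative of
  \<open>f\<close>. The factor \<open>h \<le> t\<close> raises the exponent to
  \<open>p + 1 > 0\<close>, where the power is monotone and stays bounded as \<open>t\<close> tends
  to 0.\<close>

lemma powr_mult_bound:
  fixes h p t t1 :: real
  assumes "0 < h" "h \<le> t" "t \<le> t1" "p > -1" "\<bar>v\<bar> \<le> c"
  shows "\<bar>t powr p * v\<bar> * h \<le> t1 powr (p + 1) * c"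
proof -
  have "\<bar>t powr p * v\<bar> * h \<le> t powr p * c * t"
    using assms by (auto simp: abs_mult intro!: mult_mono)
  also have "\<dots> = t powr (p + 1) * c"
    using assms by (simp add: powr_add)
  also have "\<dots> \<le> t1 powr (p + 1) * c"
    using assms by (intro mult_right_mono powr_mono2) auto
  finally show ?thesis .
qed

lemma continuous_on_Icc_bound:
  fixes v :: "real \<Rightarrow> real"
  assumes "continuous_on {a..b} v"
  obtains c where "\<And>x. x \<in> {a..b} \<Longrightarrow> \<bar>v x\<bar> \<le> c"
  using compact_imp_bounded[OF compact_continuous_image[OF assms compact_Icc]]
  unfolding bounded_iff by (metis imageI real_norm_def)

lemma gfd_left_gfi_left:
  assumes MK: "(M, K) \<in> luchko_set T" and ab: "a < b" and g: "g \<in> G_left a b"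
    and f: "f \<in> C1_left a b g" and T: "g b - g a \<le> T" and x: "x \<in> {a<..b}"
  shows "gfi_left_exists M a b g f x"
    and "gfd_left_exists K a b g (gfi_left M a b g f) x"
    and "gfd_left K a b g (gfi_left M a b g f) x = f x"
proof -
  interpret oriented_interval "{a<..b}" 1 b g "deriv_on a b g"
    by (rule oriented_interval_left[OF ab g])
  have g_mono: "strict_mono_on {a..b} g" using g by (simp add: G_left_def)
  have h_le': "h u \<le> g u - g a" for u
    using h_le[of "g a" u] strict_mono_on_leD[OF g_mono, of a] by auto
  obtain p v where p: "p > -1" and v: "continuous_on {a..b} v"
    and f': "\<And>u. u \<in> {a<..b} \<Longrightarrow> (f has_real_derivative (g u - g a) powr p * v u) (at u within {a..b})"
    using f by (auto simp: C1_left_def)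
  obtain c where c: "\<And>u. u \<in> {a..b} \<Longrightarrow> \<bar>v u\<bar> \<le> c"
    using continuous_on_Icc_bound[OF v] by blast
  have f'': "(f has_real_derivative (g u - g a) powr p * v u) (at u within {a<..b})" if "u \<in> {a<..b}" for u
    by (rule DERIV_subset[OF f'[OF that]]) auto
  have f_cont: "continuous_on {a<..b} f"
    using f'' by (rule DERIV_continuous_on)
  have f_int: "set_integrable lborel {a<..b} (\<lambda>u. f u * deriv_on a b g u)"
  proof (rule weighted_integrable[OF f''])
    fix u assume u: "u \<in> {a<..b}"
    show "\<bar>(g u - g a) powr p * v u\<bar> * h u \<le> (g b - g a) powr (p + 1) * c"
      using u h_pos[OF u] h_le'[of u] p c[of u] strict_mono_on_leD[OF g_mono, of u b]
      by (intro powr_mult_bound) auto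
  qed
  have "h b \<le> T" using h_le'[of b] T by simp
  note main = gfi_gfi[OF MK this f_cont f_int]
  have before: "{u \<in> {a<..b}. 1 * u < 1 * y} = {a<..<y}" if "y \<in> {a<..b}" for y
    using that by auto
  \<comment> \<open>Two integrands agreeing on (a, b] are allowed, so that the inner operator can be
    replaced inside the outer one.\<close>
  have gfi_left_eq: "gfi_left N a b g \<phi> y = gfi N \<psi> y"
    if "y \<in> {a<..b}" "\<And>u. u \<in> {a<..b} \<Longrightarrow> \<phi> u = \<psi> u" for N \<phi> \<psi> y
    unfolding gfi_left_def gfi_def before[OF that(1)]
    using that by (intro set_lebesgue_integral_cong) auto
  have inner: "gfi_left M a b g f u = gfi M f u" if "u \<in> {a<..b}" for u
    using gfi_left_eq[OF that] by blast
  show "gfi_left_exists M a b g f x"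
    using main(1)[OF x] unfolding gfi_left_exists_def before[OF x] by simp
  have exists: "gfi_left_exists K a b g (gfi_left M a b g f) y" if "y \<in> {a<..b}" for y
  proof -
    have "set_integrable lborel {a<..<y} (\<lambda>u. K (g y - g u) * gfi M f u * deriv_on a b g u)"
      using main(2)[OF that] unfolding before[OF that] by simp
    then show ?thesis
      unfolding gfi_left_exists_def using that inner by (subst set_integrable_cong[OF refl refl]) auto
  qed
  have "(gfi_left K a b g (gfi_left M a b g f) has_real_derivative f x * deriv_on a b g x) (at x within {a<..b})"
    using has_field_derivative_transform_within[OF main(3)[OF x] zero_less_one x] gfi_left_eq inner
    by simp
  \<comment> \<open>Derivatives within (a, b] and within [a, b] agree at \<open>x > a\<close>; at
    \<open>x = b\<close> both are one-sided.\<close>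
  moreover have "at x within {a<..b} = at x within {a..b}"
    using x by (intro at_within_nhd[of _ "{a<..}"]) auto
  ultimately have deriv: "(gfi_left K a b g (gfi_left M a b g f) has_vector_derivative f x * deriv_on a b g x) (at x within {a..b})"
    by (simp add: has_real_derivative_iff_has_vector_derivative)
  then show "gfd_left_exists K a b g (gfi_left M a b g f) x"
    unfolding gfd_left_exists_def using exists differentiableI_vector by blast
  have "x \<in> {a..b}" using x by simp
  from vector_derivative_within[OF at_within_Icc_neq_bot[OF ab this] deriv]
  show "gfd_left K a b g (gfi_left M a b g f) x = f x"
    unfolding gfd_left_def using deriv_pos[OF x] by simp
qed

text \<open>With \<open>\<sigma> = -1\<close> the iterated integral has derivative
  \<open>- f x\<close> times that of \<open>g\<close>; the minus sign in \<open>gfd_right\<close>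
  cancels this one.\<close>

lemma gfd_right_gfi_right:
  assumes MK: "(M, K) \<in> luchko_set T" and ab: "a < b" and g: "g \<in> G_right a b"
    and f: "f \<in> C1_right a b g" and T: "g b - g a \<le> T" and x: "x \<in> {a..<b}"
  shows "gfi_right_exists M a b g f x"
    and "gfd_right_exists K a b g (gfi_right M a b g f) x"
    and "gfd_right K a b g (gfi_right M a b g f) x = f x"
proof -
  interpret oriented_interval "{a..<b}" "-1" a g "deriv_on a b g"
    by (rule oriented_interval_right[OF ab g])
  have g_mono: "strict_mono_on {a..b} g" using g by (simp add: G_right_def)
  have h_le': "h u \<le> g b - g u" for u
    using h_le[of "- g b" u] strict_mono_on_leD[OF g_mono, of _ b] by auto
  obtain p v where p: "p > -1" and v: "continuous_on {a..b} v"
    and f': "\<And>u. u \<in> {a..<b} \<Longrightarrow> (f has_real_derivative (g b - g u) powr p * v u) (at u within {a..b})"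
    using f by (auto simp: C1_right_def)
  obtain c where c: "\<And>u. u \<in> {a..b} \<Longrightarrow> \<bar>v u\<bar> \<le> c"
    using continuous_on_Icc_bound[OF v] by blast
  have f'': "(f has_real_derivative (g b - g u) powr p * v u) (at u within {a..<b})" if "u \<in> {a..<b}" for u
    by (rule DERIV_subset[OF f'[OF that]]) auto
  have f_cont: "continuous_on {a..<b} f"
    using f'' by (rule DERIV_continuous_on)
  have f_int: "set_integrable lborel {a..<b} (\<lambda>u. f u * deriv_on a b g u)"
  proof (rule weighted_integrable[OF f''])
    fix u assume u: "u \<in> {a..<b}"
    show "\<bar>(g b - g u) powr p * v u\<bar> * h u \<le> (g b - g a) powr (p + 1) * c"
      using u h_pos[OF u] h_le'[of u] p c[of u] strict_mono_on_leD[OF g_mono, of a u]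
      by (intro powr_mult_bound) auto
  qed
  have "h a \<le> T" using h_le'[of a] T by simp
  note main = gfi_gfi[OF MK this f_cont f_int]
  have before: "{u \<in> {a..<b}. - 1 * u < - 1 * y} = {y<..<b}" if "y \<in> {a..<b}" for y
    using that by auto
  have gfi_right_eq: "gfi_right N a b g \<phi> y = gfi N \<psi> y"
    if "y \<in> {a..<b}" "\<And>u. u \<in> {a..<b} \<Longrightarrow> \<phi> u = \<psi> u" for N \<phi> \<psi> y
    unfolding gfi_right_def gfi_def before[OF that(1)]
    using that by (intro set_lebesgue_integral_cong) auto
  have inner: "gfi_right M a b g f u = gfi M f u" if "u \<in> {a..<b}" for u
    using gfi_right_eq[OF that] by blast
  show "gfi_right_exists M a b g f x"
    using main(1)[OF x] unfolding gfi_right_exists_def before[OF x] by simp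
  have exists: "gfi_right_exists K a b g (gfi_right M a b g f) y" if "y \<in> {a..<b}" for y
  proof -
    have "set_integrable lborel {y<..<b} (\<lambda>u. K (g u - g y) * gfi M f u * deriv_on a b g u)"
      using main(2)[OF that] unfolding before[OF that] by simp
    then show ?thesis
      unfolding gfi_right_exists_def using that inner by (subst set_integrable_cong[OF refl refl]) auto
  qed
  have "(gfi_right K a b g (gfi_right M a b g f) has_real_derivative - f x * deriv_on a b g x) (at x within {a..<b})"
    using has_field_derivative_transform_within[OF main(3)[OF x] zero_less_one x] gfi_right_eq inner
    by simp
  moreover have "at x within {a..<b} = at x within {a..b}"
    using x by (intro at_within_nhd[of _ "{..<b}"]) auto
  ultimately have deriv: "(gfi_right K a b g (gfi_right M a b g f) has_vector_derivative - f x * deriv_on a b g x) (at x within {a..b})"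
    by (simp add: has_real_derivative_iff_has_vector_derivative)
  then show "gfd_right_exists K a b g (gfi_right M a b g f) x"
    unfolding gfd_right_exists_def using exists differentiableI_vector by blast
  have "x \<in> {a..b}" using x by simp
  from vector_derivative_within[OF at_within_Icc_neq_bot[OF ab this] deriv]
  show "gfd_right K a b g (gfi_right M a b g f) x = f x"
    unfolding gfd_right_def using deriv_pos[OF x] by simp
qed

theorem theorem1:
  fixes M K :: "real \<Rightarrow> real" and a b T :: real
  assumes "a < b"
    and "(M, K) \<in> luchko_set T"
  shows
    "(\<forall>f g. g \<in> G_left a b \<longrightarrow> f \<in> C1_left a b g \<longrightarrow> g b - g a \<le> T \<longrightarrow>
       (\<forall>x\<in>{a<..b}.
          gfi_left_exists M a b g f x \<and>
          gfd_left_exists K a b g (gfi_left M a b g f) x \<and>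
          gfd_left K a b g (gfi_left M a b g f) x = f x)) \<and>
     (\<forall>f g. g \<in> G_right a b \<longrightarrow> f \<in> C1_right a b g \<longrightarrow> g b - g a \<le> T \<longrightarrow>
       (\<forall>x\<in>{a..<b}.
          gfi_right_exists M a b g f x \<and>
          gfd_right_exists K a b g (gfi_right M a b g f) x \<and>
          gfd_right K a b g (gfi_right M a b g f) x = f x))"
  using gfd_left_gfi_left[OF assms(2,1)] gfd_right_gfi_right[OF assms(2,1)] by blast

end
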